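(* Let $n\ge 1$ be an integer, let $W(3,n)$ be the weaving link, i.e. the closure of the 3-braid $(\sigma_1\sigma_2^{-1})^n$, and put $s=-t$. (1) Up to multiplication by a unit of $\mathbb{Z}[s,s^{-1}]$, the Alexander polynomial of $W(3,n)$, written in the variable $s$, is $$\Delta_{W(3,n)}(s)=\sum_{k=0}^{2n-2}\alpha_{n,k}\,s^k,\qquad \alpha_{n,k}=\sum_{i=0}^{n-1}(-1)^{k-n+i+1}\,\frac{2n\,(n+i)!}{(n-i-1)!\,(2i+2)!}\binom{i;3}{k+i-n+1},$$ where $\binom{i;3}{j}$ denotes the coefficient of $q^j$ in the expansion of $(1+q+q^2)^i$ (so it is $0$ if $j<0$ or $j>2i$). (2) The coefficients $\alpha_{n,0},\alpha_{n,1},\dots,\alpha_{n,2n-2}$ of $\Delta_{W(3,n)}(s)$ are trapezoidal.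
   Context: $B_3=\langle\sigma_1,\sigma_2\mid \sigma_1\sigma_2\sigma_1=\sigma_2\sigma_1\sigma_2\rangle$ is the braid group on 3 strands; $\hat b$ denotes the closure of a braid $b$, an oriented link. The (reduced) Burau representation $\psi_t:B_3\to GL(2,\mathbb{Z}[t,t^{-1}])$ is given by $$\psi_t(\sigma_1)=\begin{pmatrix}-t&1\\0&1\end{pmatrix},\qquad \psi_t(\sigma_2)=\begin{pmatrix}1&0\\t&-t\end{pmatrix}.$$ For a 3-braid $b$ with exponent sum $e_b$ (as a word in $\sigma_1,\sigma_2$), the Alexander polynomial of $L=\hat b$ is, up to multiplication by a unit of $\mathbb{Z}[t,t^{-1}]$, $$\Delta_L(t)=(-1/\sqrt t)^{e_b-2}\,\frac{1-t}{1-t^3}\,\det\bigl(I_2-\psi_t(b)\bigr).$$ With $s=-t$, $\Delta_L(s)$ denotes this polynomial rewritten in the variable $s$ (that is, with $t=-s$ substituted). A polynomial $\sum_{k=0}^{2N}\alpha_kx^k$ of even degree with real positive coefficients (equivalently its coefficient sequence) is called trapezoidal if there is an integer $0\le r\le N$ such that $\alpha_0<\alpha_1<\dots<\alpha_{N-r}=\dots=\alpha_{N+r}>\dots>\alpha_{2N-1}>\alpha_{2N}$. Here $N=n-1$. *)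

theory Defs
  imports
    "HOL-Analysis.Analysis"
    "HOL-Computational_Algebra.Polynomial"
    "HOL-Computational_Algebra.Fraction_Field"
    "HOL-Library.Poly_Mapping"
begin
datatype strand_gen = S1 | S2

text \<open>\<open>Pos g\<close> stands for the generator \<open>g\<close> and \<open>Neg g\<close> for its inverse.\<close>

datatype letter = Pos strand_gen | Neg strand_gen

inductive braid_equiv :: "letter list \<Rightarrow> letter list \<Rightarrow> bool" where
  refl: "braid_equiv u u"
| sym: "braid_equiv u v \<Longrightarrow> braid_equiv v u"
| trans: "braid_equiv u v \<Longrightarrow> braid_equiv v w \<Longrightarrow> braid_equiv u w"
| append: "braid_equiv u u' \<Longrightarrow> braid_equiv v v' \<Longrightarrow> braid_equiv (u @ v) (u' @ v')"
| cancel_right: "braid_equiv [Pos g, Neg g] []"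
| cancel_left: "braid_equiv [Neg g, Pos g] []"
| braid: "braid_equiv [Pos S1, Pos S2, Pos S1] [Pos S2, Pos S1, Pos S2]"

quotient_type braid3 = "letter list" / braid_equiv
  by (intro equivpI reflpI sympI transpI) (blast intro: braid_equiv.intros)+

primrec inv_letter :: "letter \<Rightarrow> letter" where
  "inv_letter (Pos g) = Neg g"
| "inv_letter (Neg g) = Pos g"

definition inv_word :: "letter list \<Rightarrow> letter list" where
  "inv_word w = rev (map inv_letter w)"

lemma inv_word_append: "inv_word (u @ v) = inv_word v @ inv_word u"
  by (simp add: inv_word_def)

lemma inv_word_right: "braid_equiv (w @ inv_word w) []"
proof (induction w)
  case Nil
  show ?case by (simp add: inv_word_def braid_equiv.refl)
next
  case (Cons x w)
  have x: "braid_equiv [x, inv_letter x] []"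
    by (cases x) (auto intro: braid_equiv.intros)
  have "braid_equiv ([x] @ (w @ inv_word w) @ [inv_letter x]) ([x] @ [] @ [inv_letter x])"
    by (intro braid_equiv.append braid_equiv.refl Cons)
  then have "braid_equiv ([x] @ (w @ inv_word w) @ [inv_letter x]) []"
    using x by (auto intro: braid_equiv.trans)
  then show ?case by (simp add: inv_word_def)
qed

lemma inv_word_inv_word: "inv_word (inv_word w) = w"
proof -
  have "inv_letter (inv_letter x) = x" for x by (cases x) auto
  then show ?thesis by (simp add: inv_word_def rev_map comp_def)
qed

lemma inv_word_left: "braid_equiv (inv_word w @ w) []"
  using inv_word_right[of "inv_word w"] by (simp add: inv_word_inv_word)

lemma inv_word_cong:
  assumes "braid_equiv u v"
  shows "braid_equiv (inv_word u) (inv_word v)"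
proof -
  have "braid_equiv (inv_word u @ (v @ inv_word v)) (inv_word u @ [])"
    by (intro braid_equiv.append braid_equiv.refl inv_word_right)
  then have 1: "braid_equiv (inv_word u) (inv_word u @ (v @ inv_word v))"
    by (auto intro: braid_equiv.sym)
  have "braid_equiv ((inv_word u @ v) @ inv_word v) ((inv_word u @ u) @ inv_word v)"
    by (intro braid_equiv.append braid_equiv.refl braid_equiv.sym[OF assms])
  moreover have "braid_equiv ((inv_word u @ u) @ inv_word v) ([] @ inv_word v)"
    by (intro braid_equiv.append braid_equiv.refl inv_word_left)
  ultimately show ?thesis using 1 by (auto intro: braid_equiv.trans)
qed

instantiation braid3 :: "{monoid_mult, inverse}"
begin

lift_definition one_braid3 :: braid3 is "[]" .

lift_definition times_braid3 :: "braid3 \<Rightarrow> braid3 \<Rightarrow> braid3" is "(@)"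
  by (rule braid_equiv.append)

lift_definition inverse_braid3 :: "braid3 \<Rightarrow> braid3" is inv_word
  by (rule inv_word_cong)

definition divide_braid3 :: "braid3 \<Rightarrow> braid3 \<Rightarrow> braid3" where
  "divide_braid3 a b = a * inverse b"

instance
  by standard (transfer; simp add: braid_equiv.refl)+

end

lemma braid3_left_inverse: "inverse b * b = (1 :: braid3)"
  by transfer (rule inv_word_left)

lemma braid3_right_inverse: "b * inverse b = (1 :: braid3)"
  by transfer (rule inv_word_right)

lift_definition \<sigma>\<^sub>1 :: braid3 is "[Pos S1]" .
lift_definition \<sigma>\<^sub>2 :: braid3 is "[Pos S2]" .

lemma braid3_relation: "\<sigma>\<^sub>1 * \<sigma>\<^sub>2 * \<sigma>\<^sub>1 = \<sigma>\<^sub>2 * \<sigma>\<^sub>1 * \<sigma>\<^sub>2"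
  by transfer (simp add: braid_equiv.braid)

primrec letter_exponent :: "letter \<Rightarrow> int" where
  "letter_exponent (Pos g) = 1"
| "letter_exponent (Neg g) = -1"

lift_definition exponent_sum :: "braid3 \<Rightarrow> int" is "\<lambda>w. \<Sum>x\<leftarrow>w. letter_exponent x"
proof -
  fix u v
  assume "braid_equiv u v"
  then show "(\<Sum>x\<leftarrow>u. letter_exponent x) = (\<Sum>x\<leftarrow>v. letter_exponent x)"
    by (induction rule: braid_equiv.induct) simp_all
qed

text \<open>The weaving link \<open>W(3,n)\<close> is the closure of this braid.\<close>

definition weaving_braid :: "nat \<Rightarrow> braid3" where
  "weaving_braid n = (\<sigma>\<^sub>1 * inverse \<sigma>\<^sub>2) ^ n"

text \<open>The integral group ring of \<open>\<int>\<close>: the Laurent monomial with exponent \<open>k\<close> and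
  coefficient \<open>c\<close> is \<open>Poly_Mapping.single k c\<close>.\<close>

type_synonym laurent = "int \<Rightarrow>\<^sub>0 int"

definition tvar :: laurent where
  "tvar = Poly_Mapping.single 1 1"

definition laurent_eval :: "'a :: field \<Rightarrow> laurent \<Rightarrow> 'a" where
  "laurent_eval x p = (\<Sum>k\<in>Poly_Mapping.keys p. of_int (Poly_Mapping.lookup p k) * x powi k)"

primrec burau_gen :: "strand_gen \<Rightarrow> laurent^2^2" where
  "burau_gen S1 = vector [vector [- tvar, 1], vector [0, 1]]"
| "burau_gen S2 = vector [vector [1, 0], vector [tvar, - tvar]]"

primrec burau_letter :: "letter \<Rightarrow> laurent^2^2" where
  "burau_letter (Pos g) = burau_gen g"
| "burau_letter (Neg g) = matrix_inv (burau_gen g)"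

primrec burau_word :: "letter list \<Rightarrow> laurent^2^2" where
  "burau_word [] = mat 1"
| "burau_word (x # w) = burau_letter x ** burau_word w"

lemma matrix_2_eqI:
  fixes A B :: "'a^2^2"
  assumes "A $ 1 $ 1 = B $ 1 $ 1" "A $ 1 $ 2 = B $ 1 $ 2"
    "A $ 2 $ 1 = B $ 2 $ 1" "A $ 2 $ 2 = B $ 2 $ 2"
  shows "A = B"
  using assms by (simp add: vec_eq_iff forall_2)

lemma burau_gen_invertible: "invertible (burau_gen g)"
proof -
  define ti :: laurent where "ti = Poly_Mapping.single (-1) 1"
  have t: "tvar * ti = 1" "ti * tvar = 1"
    by (simp_all add: tvar_def ti_def Poly_Mapping.mult_single)
  show ?thesis
  proof (cases g)
    case S1
    let ?B = "vector [vector [- ti, ti], vector [0, 1]] :: laurent^2^2"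
    have "burau_gen S1 ** ?B = mat 1" "?B ** burau_gen S1 = mat 1"
      by (rule matrix_2_eqI; simp add: matrix_matrix_mult_def sum_2 mat_def t)+
    then show ?thesis unfolding invertible_def S1 by blast
  next
    case S2
    let ?B = "vector [vector [1, 0], vector [1, - ti]] :: laurent^2^2"
    have "burau_gen S2 ** ?B = mat 1" "?B ** burau_gen S2 = mat 1"
      by (rule matrix_2_eqI; simp add: matrix_matrix_mult_def sum_2 mat_def t)+
    then show ?thesis unfolding invertible_def S2 by blast
  qed
qed

lemma burau_gen_inverse:
  "burau_gen g ** matrix_inv (burau_gen g) = mat 1"
  "matrix_inv (burau_gen g) ** burau_gen g = mat 1"
proof -
  have "\<exists>B. burau_gen g ** B = mat 1 \<and> B ** burau_gen g = mat 1"
    using burau_gen_invertible[of g] by (simp add: invertible_def)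
  from someI_ex[OF this]
  show "burau_gen g ** matrix_inv (burau_gen g) = mat 1"
    "matrix_inv (burau_gen g) ** burau_gen g = mat 1"
    by (simp_all add: matrix_inv_def)
qed

lemma burau_word_append: "burau_word (u @ v) = burau_word u ** burau_word v"
  by (induction u) (simp_all add: matrix_mul_assoc)

lift_definition burau :: "braid3 \<Rightarrow> laurent^2^2" is burau_word
proof -
  fix u v
  assume "braid_equiv u v"
  then show "burau_word u = burau_word v"
  proof (induction rule: braid_equiv.induct)
    case braid
    show ?case
      by (rule matrix_2_eqI)
        (simp_all add: matrix_matrix_mult_def sum_2 mat_def algebra_simps)
  qed (simp_all add: burau_word_append burau_gen_inverse)
qed

lemma burau_mult: "burau (a * b) = burau a ** burau b"
  by transfer (rule burau_word_append)

text \<open>The Alexander polynomial of the closure of \<open>b\<close> enters through its Burau-matrix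
  expression, which is meaningful up to units of \<open>\<int>[t, t\<^sup>-\<^sup>1]\<close>. For odd \<open>exponent_sum b\<close> the normalising factor involves \<open>\<surd>t\<close>, and it also has a
  denominator, so the defining formula is read in the field of rational functions in
  \<open>\<surd>t\<close>.\<close>

type_synonym sqrt_ratfun = "int poly fract"

definition sqrt_t :: sqrt_ratfun where
  "sqrt_t = Fract [:0, 1:] 1"

definition alexander :: "braid3 \<Rightarrow> sqrt_ratfun" where
  "alexander b = (let t = sqrt_t ^ 2 in
     (- 1 / sqrt_t) powi (exponent_sum b - 2) * ((1 - t) / (1 - t ^ 3)) *
     laurent_eval t (det (mat 1 - burau b)))"

text \<open>Here \<open>P\<close> and the unit \<open>c\<close> are Laurent polynomials in the variable \<open>s = -t\<close>;
  both sides are compared after substituting \<open>s = -t\<close>.\<close>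

definition is_alexander_in_s :: "braid3 \<Rightarrow> laurent \<Rightarrow> bool" where
  "is_alexander_in_s b P \<longleftrightarrow>
     (\<exists>c. c dvd 1 \<and>
       laurent_eval (- (sqrt_t ^ 2)) P = laurent_eval (- (sqrt_t ^ 2)) c * alexander b)"

definition trinomial :: "nat \<Rightarrow> int \<Rightarrow> int" where
  "trinomial i j = (if j < 0 then 0 else coeff ([:1, 1, 1:] ^ i) (nat j))"

definition alpha :: "nat \<Rightarrow> nat \<Rightarrow> real" where
  "alpha n k = (\<Sum>i<n. (- 1) powi (int k - int n + int i + 1) *
     (real (2 * n) * fact (n + i) / (fact (n - i - 1) * fact (2 * i + 2))) *
     of_int (trinomial i (int k + int i - int n + 1)))"

text \<open>The sequence \<open>a\<^sub>0, \<dots>, a\<^bsub>2N\<^esub>\<close> is trapezoidal; values of \<open>a\<close> beyond index \<open>2N\<close> are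
  irrelevant.\<close>

definition trapezoidal :: "nat \<Rightarrow> (nat \<Rightarrow> real) \<Rightarrow> bool" where
  "trapezoidal N a \<longleftrightarrow>
     (\<forall>k\<le>2 * N. 0 < a k) \<and>
     (\<exists>r\<le>N. (\<forall>k<N - r. a k < a (Suc k)) \<and>
            (\<forall>k\<in>{N - r..<N + r}. a k = a (Suc k)) \<and>
            (\<forall>k\<in>{N + r..<2 * N}. a k > a (Suc k)))"

end

theory Submission
  imports Defs
begin

text \<open>
  Put \<open>\<tau> = s + 1 + s\<^sup>-\<^sup>1\<close>, the trace of the Burau matrix \<open>M\<close> of \<open>\<sigma>\<^sub>1 \<sigma>\<^sub>2\<^sup>-\<^sup>1\<close>. Since \<open>det M = 1\<close>, the
  Alexander polynomial is \<open>P\<^sub>n = (tr M\<^sup>n - 2) / (\<tau> - 2)\<close>, which satisfies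
  \<open>P\<^bsub>n+2\<^esub> = \<tau> P\<^bsub>n+1\<^esub> - P\<^sub>n + 2\<close>. Expanding \<open>P\<^sub>n\<close> in powers of \<open>\<tau> - 2\<close> gives the formula for the
  coefficients.

  For trapezoidality, let \<open>v = z + z\<^sup>2 + \<dots>\<close> be the power series with \<open>v + v\<^sup>-\<^sup>1 + 1 = z + z\<^sup>-\<^sup>1\<close>. The
  coefficient of \<open>s\<^sup>k\<close> in \<open>\<Sum>\<^sub>n P\<^sub>n z\<^sup>n\<close> is a fixed series times \<open>v\<^bsup>|k|\<^esup>\<close>, and two consecutive ones
  (\<open>|k|\<close> and \<open>|k| + 1\<close>) differ by \<open>z (1 + z) / (1 - z) \<cdot> v\<^bsup>|k|\<^esup> / (1 - z (v - z))\<close>. All these series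
  have nonnegative coefficients because \<open>g = v - z\<close> satisfies the positive fixed-point equation
  \<open>g = z\<^sup>2 + z g + z\<^sup>2 g + z g\<^sup>2\<close>. Hence the coefficients of \<open>P\<^sub>n\<close> decrease strictly away from the centre.
\<close>

subsection \<open>Expansion of the Alexander polynomial in powers of \<open>\<tau> - 2\<close>\<close>

text \<open>The coefficient of \<open>(\<tau> - 2)\<^sup>i\<close> in \<open>P\<^sub>n\<close>, that is \<open>n/(i+1) \<cdot> binomial (n + i) (2i + 1)\<close>, written so that
  no division occurs.\<close>

definition wheel_coeff :: "nat \<Rightarrow> nat \<Rightarrow> nat" where
  "wheel_coeff n i = ((n + i + 1) choose (2 * i + 2)) + ((n + i) choose (2 * i + 2))"

lemma wheel_coeff_eq_0: "n \<le> i \<Longrightarrow> wheel_coeff n i = 0"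
  by (simp add: wheel_coeff_def binomial_eq_0)

text \<open>With the \<open>Suc\<close> case below, these are the coefficients of P_(n+2) + P_n = (2
  + x) P_(n+1) + 2 in powers of x = \<tau> - 2; both come from Pascal's rule.\<close>

lemma wheel_coeff_rec_0:
  "wheel_coeff (n + 2) 0 + wheel_coeff n 0 = 2 * wheel_coeff (n + 1) 0 + 2"
  by (simp add: wheel_coeff_def numeral_2_eq_2)

lemma wheel_coeff_rec_Suc:
  "wheel_coeff (n + 2) (Suc i) + wheel_coeff n (Suc i) =
     2 * wheel_coeff (n + 1) (Suc i) + wheel_coeff (n + 1) i"
  by (simp add: wheel_coeff_def numeral_2_eq_2)

lemma wheel_coeff_fact:
  assumes "i < n"
  shows "real (wheel_coeff n i) =
    real (2 * n) * fact (n + i) / (fact (n - i - 1) * fact (2 * i + 2))"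
proof -
  obtain d where n: "n = i + 1 + d"
    using assms by (metis Suc_eq_plus1 less_iff_Suc_add add_Suc_right add.commute plus_1_eq_Suc)
  have 1: "real ((n + i + 1) choose (2 * i + 2)) = fact (n + i + 1) / (fact (2 * i + 2) * fact d)"
    by (subst binomial_fact) (simp_all add: n)
  \<comment> \<open>The factor \<open>d\<close> makes the formula cover \<open>d = 0\<close>, where
    the binomial coefficient vanishes.\<close>
  have 2: "real ((n + i) choose (2 * i + 2)) = real d * fact (n + i) / (fact (2 * i + 2) * fact d)"
  proof (cases d)
    case 0
    then show ?thesis by (simp add: n binomial_eq_0)
  next
    case (Suc e)
    then show ?thesis
      by (subst binomial_fact) (simp_all add: n divide_simps)
  qed
  have "fact (n + i + 1) = real (n + i + 1) * fact (n + i)" by simp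
  then have "real (wheel_coeff n i) =
      (real (n + i + 1) + real d) * fact (n + i) / (fact (2 * i + 2) * fact d)"
    unfolding wheel_coeff_def of_nat_add[of "_ choose _"] 1 2 by (simp only: add_divide_distrib distrib_right)
  also have "real (n + i + 1) + real d = real (2 * n)" by (simp add: n)
  finally show ?thesis by (simp add: n mult.commute)
qed

text \<open>\<open>P\<^sub>n\<close> with \<open>\<tau> - 2 = u / a\<close> and denominators cleared. The choices \<open>a = 1\<close> (Burau traces) and
  \<open>a = s\<close>, \<open>u = 1 - s + s\<^sup>2\<close> (the polynomial in \<open>s\<close>) are both needed.\<close>

definition wheel_form :: "'a :: comm_ring_1 \<Rightarrow> 'a \<Rightarrow> nat \<Rightarrow> 'a" where
  "wheel_form a u n = (\<Sum>i<n. of_nat (wheel_coeff n i) * a ^ (n - 1 - i) * u ^ i)"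

lemma wheel_form_0 [simp]: "wheel_form a u 0 = 0"
  by (simp add: wheel_form_def)

lemma wheel_form_1 [simp]: "wheel_form a u (Suc 0) = 1"
  by (simp add: wheel_form_def wheel_coeff_def numeral_2_eq_2)

text \<open>Brings the forms for n, n + 1 and n + 2 to matching powers of \<open>a\<close> and one
  summation range, so that the coefficient recurrences apply termwise.\<close>

lemma wheel_form_shift:
  assumes "n \<le> Suc N"
  shows "a ^ d * wheel_form a u n =
    of_nat (wheel_coeff n 0) * a ^ (n + d - 1) +
    (\<Sum>i<N. of_nat (wheel_coeff n (Suc i)) * a ^ (n + d - 2 - i) * u ^ Suc i)"
proof -
  have "a ^ d * wheel_form a u n =
      (\<Sum>i<n. of_nat (wheel_coeff n i) * a ^ (n + d - 1 - i) * u ^ i)"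
    unfolding wheel_form_def sum_distrib_left
  proof (rule sum.cong)
    fix i assume "i \<in> {..<n}"
    then have "n + d - 1 - i = d + (n - 1 - i)" by auto
    then show "a ^ d * (of_nat (wheel_coeff n i) * a ^ (n - 1 - i) * u ^ i) =
        of_nat (wheel_coeff n i) * a ^ (n + d - 1 - i) * u ^ i"
      by (simp add: power_add mult_ac)
  qed simp
  also have "\<dots> = (\<Sum>i<Suc N. of_nat (wheel_coeff n i) * a ^ (n + d - 1 - i) * u ^ i)"
    using assms by (intro sum.mono_neutral_left) (auto simp: wheel_coeff_eq_0)
  also have "\<dots> = of_nat (wheel_coeff n 0) * a ^ (n + d - 1) +
      (\<Sum>i<N. of_nat (wheel_coeff n (Suc i)) * a ^ (n + d - 2 - i) * u ^ Suc i)"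
    by (subst sum.lessThan_Suc_shift) (simp add: numeral_2_eq_2)
  finally show ?thesis .
qed

lemma wheel_form_rec:
  "wheel_form a u (n + 2) =
    (u + 2 * a) * wheel_form a u (n + 1) - a ^ 2 * wheel_form a u n + 2 * a ^ (n + 1)"
proof -
  have u: "u * wheel_form a u (n + 1) =
      (\<Sum>i<n+1. of_nat (wheel_coeff (n + 1) i) * a ^ (n - i) * u ^ Suc i)"
    unfolding wheel_form_def sum_distrib_left by (intro sum.cong) (simp_all add: mult_ac)
  have "wheel_form a u (n + 2) + a ^ 2 * wheel_form a u n =
      of_nat (wheel_coeff (n + 2) 0 + wheel_coeff n 0) * a ^ (n + 1) +
      (\<Sum>i<n+1. of_nat (wheel_coeff (n + 2) (Suc i) + wheel_coeff n (Suc i)) * a ^ (n - i) * u ^ Suc i)"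
    using wheel_form_shift[of "n + 2" "n + 1" a 0 u] wheel_form_shift[of n "n + 1" a 2 u]
    by (simp add: algebra_simps sum.distrib)
  also have "\<dots> = 2 * (a ^ 1 * wheel_form a u (n + 1)) + 2 * a ^ (n + 1) + u * wheel_form a u (n + 1)"
    unfolding wheel_coeff_rec_0 wheel_coeff_rec_Suc u
    using wheel_form_shift[of "n + 1" "n + 1" a 1 u]
    by (simp add: algebra_simps sum.distrib sum_distrib_left)
  finally show ?thesis by (simp add: algebra_simps)
qed

text \<open>The power of \<open>a\<close> split off here later becomes the unit between
  \<open>wheel_poly\<close> and the Alexander polynomial.\<close>

lemma wheel_form_homogeneous:
  "wheel_form a (a * u) (Suc n) = a ^ n * wheel_form 1 u (Suc n)"
  unfolding wheel_form_def sum_distrib_left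
proof (rule sum.cong)
  fix i assume "i \<in> {..<Suc n}"
  then have "a ^ n = a ^ (Suc n - 1 - i) * a ^ i"
    by (simp flip: power_add)
  then show "of_nat (wheel_coeff (Suc n) i) * a ^ (Suc n - 1 - i) * (a * u) ^ i =
      a ^ n * (of_nat (wheel_coeff (Suc n) i) * 1 ^ (Suc n - 1 - i) * u ^ i)"
    by (simp add: power_mult_distrib mult_ac)
qed simp

lemma wheel_form_hom:
  assumes "f 0 = 0" "f 1 = 1" "\<And>x y. f (x + y) = f x + f y" "\<And>x y. f (x * y) = f x * f y"
  shows "f (wheel_form a u n) = wheel_form (f a) (f u) n"
proof -
  have p: "f (x ^ k) = f x ^ k" for x k by (induction k) (simp_all add: assms)
  have n: "f (of_nat k) = of_nat k" for k by (induction k) (simp_all add: assms)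
  have s: "f (\<Sum>i<k. h i) = (\<Sum>i<k. f (h i))" for h and k :: nat
    by (induction k) (simp_all add: assms)
  show ?thesis by (simp add: wheel_form_def s p n assms(4))
qed

definition wheel_poly :: "nat \<Rightarrow> int poly" where
  "wheel_poly = wheel_form [:0, 1:] [:1, - 1, 1:]"

text \<open>Replacing q by -q turns 1 + q + q^2 into 1 - q + q^2; this is the source of the signs in
  \<open>alpha\<close>.\<close>

lemma coeff_alternating_trinomial:
  "coeff ([:1, - 1, 1:] ^ i) j = (- 1) ^ j * coeff ([:1, 1, 1 :: int:] ^ i) j"
proof (induction i arbitrary: j)
  case 0
  show ?case by (cases j) simp_all
next
  case (Suc i)
  show ?case
    by (simp add: Suc coeff_pCons algebra_simps split: nat.split)
qed

lemma alpha_eq_coeff: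
  "alpha n k = real_of_int (coeff (wheel_poly n) k)"
proof -
  have "(- 1) powi (int k - int n + int i + 1) *
      (real (2 * n) * fact (n + i) / (fact (n - i - 1) * fact (2 * i + 2))) *
      of_int (trinomial i (int k + int i - int n + 1)) =
      real_of_int (coeff (of_nat (wheel_coeff n i) * [:0, 1:] ^ (n - 1 - i) * [:1, - 1, 1:] ^ i) k)"
    (is "_ = real_of_int (coeff ?q k)") if "i < n" for i
  proof -
    \<comment> \<open>The power of s shifts indices by n - 1 - i; below that shift the trinomial
      index in \<open>alpha\<close> is negative, so both sides vanish.\<close>
    have q: "coeff ?q k = (if k < n - 1 - i then 0
        else int (wheel_coeff n i) * coeff ([:1, - 1, 1:] ^ i) (k - (n - 1 - i)))"
      by (simp add: of_nat_poly mult.assoc coeff_monom_mult flip: monom_altdef[of "1::int", simplified])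
    show ?thesis
    proof (cases "k < n - 1 - i")
      case True
      then show ?thesis
        unfolding q by (simp add: trinomial_def)
    next
      case False
      then obtain j where j: "k = n - 1 - i + j" by (metis le_add_diff_inverse linorder_not_le)
      have 1: "int k - int n + int i + 1 = int j" "int k + int i - int n + 1 = int j"
        using that j by auto
      show ?thesis
        unfolding 1 wheel_coeff_fact[OF that, symmetric] q
        by (simp add: j trinomial_def coeff_alternating_trinomial)
    qed
  qed
  then show ?thesis
    unfolding alpha_def wheel_poly_def wheel_form_def coeff_sum of_int_sum by (intro sum.cong) auto
qed

subsection \<open>The Burau matrix of the weaving braid\<close>

lemma laurent_eval_superset:
  assumes "finite S" "Poly_Mapping.keys p \<subseteq> S"
  shows "laurent_eval x p = (\<Sum>k\<in>S. of_int (Poly_Mapping.lookup p k) * x powi k)"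
  unfolding laurent_eval_def using assms
  by (intro sum.mono_neutral_left) (auto simp: in_keys_iff)

lemma laurent_eval_0 [simp]: "laurent_eval x 0 = 0"
  by (simp add: laurent_eval_def)

lemma laurent_eval_single [simp]: "laurent_eval x (Poly_Mapping.single k c) = of_int c * x powi k"
  by (simp add: laurent_eval_def)

lemma laurent_eval_1 [simp]: "laurent_eval x 1 = 1"
  by (simp flip: single_one)

lemma laurent_eval_add: "laurent_eval x (p + q) = laurent_eval x p + laurent_eval x q"
proof -
  let ?S = "Poly_Mapping.keys p \<union> Poly_Mapping.keys q"
  have "laurent_eval x (p + q) = (\<Sum>k\<in>?S. of_int (Poly_Mapping.lookup (p + q) k) * x powi k)"
    by (intro laurent_eval_superset keys_add) simp
  also have "\<dots> = (\<Sum>k\<in>?S. of_int (Poly_Mapping.lookup p k) * x powi k) +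
      (\<Sum>k\<in>?S. of_int (Poly_Mapping.lookup q k) * x powi k)"
    by (simp add: lookup_add distrib_right sum.distrib)
  also have "\<dots> = laurent_eval x p + laurent_eval x q"
    by (simp flip: laurent_eval_superset)
  finally show ?thesis .
qed

lemma laurent_eval_uminus: "laurent_eval x (- p) = - laurent_eval x p"
  using laurent_eval_add[of x p "- p"] by (simp add: eq_neg_iff_add_eq_0 add.commute)

lemma laurent_eval_sum: "laurent_eval x (\<Sum>i\<in>I. f i) = (\<Sum>i\<in>I. laurent_eval x (f i))"
  by (induction I rule: infinite_finite_induct) (simp_all add: laurent_eval_add)

lemma laurent_sum_single: "(\<Sum>k\<in>Poly_Mapping.keys p. Poly_Mapping.single k (Poly_Mapping.lookup p k)) = p"
  by (rule poly_mapping_eqI) (auto simp: lookup_sum lookup_single when_def in_keys_iff)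

lemma laurent_eval_mult:
  assumes "x \<noteq> 0"
  shows "laurent_eval x (p * q) = laurent_eval x p * laurent_eval x q"
proof -
  have "p * q = (\<Sum>k\<in>Poly_Mapping.keys p. \<Sum>l\<in>Poly_Mapping.keys q.
      Poly_Mapping.single (k + l) (Poly_Mapping.lookup p k * Poly_Mapping.lookup q l))"
    by (subst (1 2) laurent_sum_single[symmetric]) (simp only: sum_product mult_single)
  also have "laurent_eval x \<dots> = laurent_eval x p * laurent_eval x q"
    unfolding laurent_eval_sum laurent_eval_single laurent_eval_def[of x p] laurent_eval_def[of x q] sum_product
    using assms by (intro sum.cong) (simp_all add: power_int_add mult_ac)
  finally show ?thesis .
qed

section \<open>Burau matrices, their traces and determinants\<close>

definition tinv :: laurent where
  "tinv = Poly_Mapping.single (- 1) 1"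

lemma tvar_tinv: "tvar * tinv = 1" "tinv * tvar = 1"
  by (simp_all add: tvar_def tinv_def Poly_Mapping.mult_single)

lemma burau_\<sigma>\<^sub>1: "burau \<sigma>\<^sub>1 = vector [vector [- tvar, 1], vector [0, 1]]"
  by transfer simp

lemma burau_\<sigma>\<^sub>2: "burau \<sigma>\<^sub>2 = vector [vector [1, 0], vector [tvar, - tvar]]"
  by transfer simp

lemma burau_1: "burau 1 = mat 1"
  by transfer simp

text \<open>\<open>matrix_inv\<close> is a choice, so uniqueness of inverses is used: the explicit
  matrix is a left inverse of \<open>burau \<sigma>\<^sub>2\<close>, and
  \<open>burau (inverse \<sigma>\<^sub>2)\<close> is a right one.\<close>

lemma burau_inverse_\<sigma>\<^sub>2: "burau (inverse \<sigma>\<^sub>2) = vector [vector [1, 0], vector [1, - tinv]]"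
  (is "_ = ?B")
proof -
  have "?B ** burau \<sigma>\<^sub>2 = mat 1"
    unfolding burau_\<sigma>\<^sub>2 by (rule matrix_2_eqI; simp add: matrix_matrix_mult_def sum_2 mat_def tvar_tinv)
  then have "burau (inverse \<sigma>\<^sub>2) = ?B ** burau \<sigma>\<^sub>2 ** burau (inverse \<sigma>\<^sub>2)"
    by simp
  also have "\<dots> = ?B ** burau (\<sigma>\<^sub>2 * inverse \<sigma>\<^sub>2)"
    unfolding burau_mult by (simp only: matrix_mul_assoc)
  finally show ?thesis
    by (simp add: braid3_right_inverse burau_1)
qed

lemma burau_weaving_generator:
  "burau (\<sigma>\<^sub>1 * inverse \<sigma>\<^sub>2) = vector [vector [1 - tvar, - tinv], vector [1, - tinv]]"
  unfolding burau_mult burau_\<sigma>\<^sub>1 burau_inverse_\<sigma>\<^sub>2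
  by (rule matrix_2_eqI; simp add: matrix_matrix_mult_def sum_2 tvar_tinv)

lemma burau_power_Suc: "burau (b ^ Suc n) = burau b ** burau (b ^ n)"
  by (simp add: burau_mult)

lemma det_burau_power:
  assumes "det (burau b) = 1"
  shows "det (burau (b ^ n)) = 1"
  by (induction n) (simp_all only: power_0 burau_1 burau_power_Suc det_mul assms det_I mult_1)

text \<open>Multiply A^2 = (tr A) A - (det A) I by B and take traces.\<close>

lemma cayley_hamilton_2:
  fixes A B :: "'a :: comm_ring_1^2^2"
  assumes "det A = 1"
  shows "trace (A ** (A ** B)) = trace A * trace (A ** B) - trace B"
proof -
  have "trace (A ** (A ** B)) = trace A * trace (A ** B) - det A * trace B"
    by (simp add: det_2 trace_def matrix_matrix_mult_def sum_2 algebra_simps)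
  then show ?thesis by (simp add: assms)
qed

lemma det_1_minus:
  fixes A :: "'a :: comm_ring_1^2^2"
  shows "det (mat 1 - A) = 1 - trace A + det A"
  by (simp add: det_2 trace_def sum_2 mat_def algebra_simps)

text \<open>The traces satisfy t_(n+2) = \<tau> t_(n+1) - t_n with t_0 = 2 and t_1 = \<tau>. Writing
  t_n = (\<tau> - 2) P_n + 2 produces the inhomogeneous 2 in the recurrence of P_n.\<close>

lemma trace_burau_power:
  assumes "det (burau b) = 1"
  shows "trace (burau (b ^ n)) = (trace (burau b) - 2) * wheel_form 1 (trace (burau b) - 2) n + 2"
proof (induction n rule: less_induct)
  case (less n)
  consider "n = 0" | "n = 1" | m where "n = m + 2"
    by (metis One_nat_def add_2_eq_Suc' not0_implies_Suc)
  then show ?case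
  proof cases
    case 1
    then show ?thesis by (simp add: burau_1 trace_def mat_def)
  next
    case 2
    then show ?thesis by simp
  next
    case 3
    have "trace (burau (b ^ n)) = trace (burau b) * trace (burau (b ^ (m + 1))) - trace (burau (b ^ m))"
      using cayley_hamilton_2[OF assms, of "burau (b ^ m)"] by (simp add: 3 burau_mult)
    moreover have "trace (burau (b ^ m)) = (trace (burau b) - 2) * wheel_form 1 (trace (burau b) - 2) m + 2"
      "trace (burau (b ^ (m + 1))) =
        (trace (burau b) - 2) * wheel_form 1 (trace (burau b) - 2) (m + 1) + 2"
      by (simp_all only: less 3 less_add_Suc1 add_2_eq_Suc' Suc_eq_plus1 add_less_cancel_left)
    \<comment> \<open>The unsimplified \<open>2 * 1\<close> and \<open>1 ^ 2\<close> match
      \<open>wheel_form_rec\<close> at \<open>a = 1\<close> literally.\<close>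
    moreover have "\<tau> * ((\<tau> - 2) * x + 2) - ((\<tau> - 2) * y + 2) =
        (\<tau> - 2) * ((\<tau> - 2 + 2 * 1) * x - 1 ^ 2 * y + 2 * 1 ^ (m + 1)) + 2" for \<tau> x y :: laurent
      by (simp add: algebra_simps)
    ultimately show ?thesis
      unfolding 3 wheel_form_rec by (simp only:)
  qed
qed

text \<open>As det M = 1, the determinant is 2 - tr M^n, and 2 - \<tau> = 1 + t + 1/t.\<close>

lemma det_1_minus_burau_weaving:
  "det (mat 1 - burau (weaving_braid n)) =
    (1 + tvar + tinv) * wheel_form 1 (- (1 + tvar + tinv)) n"
proof -
  let ?b = "\<sigma>\<^sub>1 * inverse \<sigma>\<^sub>2"
  have d: "det (burau ?b) = 1"
    unfolding burau_weaving_generator by (simp add: det_2 algebra_simps tvar_tinv)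
  have t: "trace (burau ?b) - 2 = - (1 + tvar + tinv)"
    unfolding burau_weaving_generator by (simp add: trace_def sum_2)
  show ?thesis
    unfolding weaving_braid_def det_1_minus det_burau_power[OF d] trace_burau_power[OF d] t
    by (simp add: algebra_simps)
qed

section \<open>The normalising factor and the passage to s\<close>

lemma exponent_sum_mult: "exponent_sum (a * b) = exponent_sum a + exponent_sum b"
  by transfer simp

lemma exponent_sum_1: "exponent_sum 1 = 0"
  by transfer simp

lemma exponent_sum_weaving_braid: "exponent_sum (weaving_braid n) = 0"
proof -
  have "exponent_sum (\<sigma>\<^sub>1 * inverse \<sigma>\<^sub>2) = 0"
    by transfer (simp add: inv_word_def)
  then show ?thesis
    unfolding weaving_braid_def by (induction n) (simp_all add: exponent_sum_mult exponent_sum_1)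
qed

lemma sqrt_t_neq_0: "sqrt_t \<noteq> 0"
  by (simp add: sqrt_t_def eq_fract Zero_fract_def)

lemma sqrt_t_power: "sqrt_t ^ k = Fract (monom 1 k) 1"
  by (induction k) (simp_all add: sqrt_t_def One_fract_def monom_altdef one_pCons)

lemma sqrt_t_power_neq_1:
  assumes "k > 0"
  shows "sqrt_t ^ k \<noteq> 1"
proof
  assume "sqrt_t ^ k = 1"
  then have "monom 1 k = (1 :: int poly)"
    by (simp add: sqrt_t_power One_fract_def eq_fract)
  then have "degree (monom 1 k :: int poly) = 0" by simp
  then show False using assms by (simp add: degree_monom_eq)
qed

lemma alexander_weaving_braid:
  fixes t defines "t \<equiv> sqrt_t ^ 2"
  shows "alexander (weaving_braid n) = wheel_form 1 (- (1 + t + inverse t)) n"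
proof -
  have t0: "t \<noteq> 0" by (simp add: t_def sqrt_t_neq_0)
  have t3: "1 - t ^ 3 \<noteq> 0"
    using sqrt_t_power_neq_1[of 6] by (simp add: t_def flip: power_mult)
  have unit: "(- 1 / sqrt_t) powi (- 2) = t"
    by (simp add: t_def power_int_minus power_divide)
  have ev: "laurent_eval t (wheel_form a u n) = wheel_form (laurent_eval t a) (laurent_eval t u) n" for a u
    by (rule wheel_form_hom) (simp_all add: laurent_eval_add laurent_eval_mult t0)
  have u: "laurent_eval t (1 + tvar + tinv) = 1 + t + inverse t"
    by (simp add: laurent_eval_add tvar_def tinv_def power_int_minus)
  have "alexander (weaving_braid n) =
      t * ((1 - t) / (1 - t ^ 3)) * (1 + t + inverse t) * wheel_form 1 (- (1 + t + inverse t)) n"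
    unfolding alexander_def Let_def exponent_sum_weaving_braid det_1_minus_burau_weaving t_def[symmetric]
    using unit by (simp only: laurent_eval_mult[OF t0] ev laurent_eval_uminus u laurent_eval_1) simp
  \<comment> \<open>Since 1 - t^3 = (1 - t)(1 + t + t^2), the prefactor cancels the factor 1 + t +
    1/t of the determinant exactly.\<close>
  also have "t * ((1 - t) / (1 - t ^ 3)) * (1 + t + inverse t) = 1"
    using t0 t3 by (simp add: divide_simps) (simp add: algebra_simps power3_eq_cube)
  finally show ?thesis by simp
qed

lemma degree_wheel_poly: "degree (wheel_poly n) \<le> 2 * n - 2"
  unfolding wheel_poly_def wheel_form_def
proof (intro degree_sum_le)
  fix i assume i: "i \<in> {..<n}"
  have 1: "degree ([:0, 1 :: int:] ^ (n - 1 - i)) \<le> n - 1 - i"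
    using degree_power_le[of "[:0, 1 :: int:]" "n - 1 - i"] by simp
  have 2: "degree ([:1, - 1, 1 :: int:] ^ i) \<le> 2 * i"
    using degree_power_le[of "[:1, - 1, 1 :: int:]" i] by simp
  have "degree (of_nat (wheel_coeff n i) * [:0, 1:] ^ (n - 1 - i) * [:1, - 1, 1 :: int:] ^ i)
      \<le> degree (of_nat (wheel_coeff n i) :: int poly) + degree ([:0, 1 :: int:] ^ (n - 1 - i)) + degree ([:1, - 1, 1 :: int:] ^ i)"
    by (meson add_mono degree_mult_le order.refl order.trans)
  then show "degree (of_nat (wheel_coeff n i) * [:0, 1:] ^ (n - 1 - i) * [:1, - 1, 1 :: int:] ^ i) \<le> 2 * n - 2"
    using 1 2 i by simp
qed simp

lemma poly_wheel_poly:
  fixes s :: "'a :: comm_ring_1"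
  shows "poly (map_poly of_int (wheel_poly n)) s = wheel_form s (1 - s + s ^ 2) n"
proof -
  have "map_poly of_int (p + q) = (map_poly of_int p + map_poly of_int q :: 'a poly)" for p q
    by (rule poly_eqI) (simp add: coeff_map_poly)
  moreover have "map_poly of_int (p * q) = (map_poly of_int p * map_poly of_int q :: 'a poly)" for p q
    by (rule poly_eqI) (simp add: coeff_map_poly coeff_mult)
  ultimately have "poly (map_poly of_int (wheel_form a u n)) s =
      wheel_form (poly (map_poly of_int a) s) (poly (map_poly of_int u) s) n" for a u
    by (intro wheel_form_hom[where f = "\<lambda>p. poly (map_poly of_int p) s"]) (simp_all add: map_poly_1)
  then show ?thesis
    by (simp add: wheel_poly_def map_poly_pCons algebra_simps power2_eq_square)
qed

lemma is_alexander_weaving_braid: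
  assumes "n \<ge> 1"
  shows "is_alexander_in_s (weaving_braid n)
    (\<Sum>k\<le>2 * n - 2. Poly_Mapping.single (int k) (coeff (wheel_poly n) k))"
proof -
  define s where "s = - (sqrt_t ^ 2)"
  have s0: "s \<noteq> 0" by (simp add: s_def sqrt_t_neq_0)
  \<comment> \<open>The unit s^(n-1) clears the negative powers of s in P_n.\<close>
  define c :: laurent where "c = Poly_Mapping.single (int (n - 1)) 1"
  obtain m where m: "n = Suc m" using assms by (cases n) auto
  have "c * Poly_Mapping.single (- int (n - 1)) 1 = 1"
    by (simp add: c_def mult_single)
  then have "c dvd 1" by (metis dvdI)
  moreover have "laurent_eval s (\<Sum>k\<le>2 * n - 2. Poly_Mapping.single (int k) (coeff (wheel_poly n) k)) =
      laurent_eval s c * alexander (weaving_braid n)"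
  proof -
    have "laurent_eval s (\<Sum>k\<le>2 * n - 2. Poly_Mapping.single (int k) (coeff (wheel_poly n) k)) =
        (\<Sum>k\<le>2 * n - 2. coeff (map_poly of_int (wheel_poly n)) k * s ^ k)"
      by (simp add: laurent_eval_sum coeff_map_poly)
    also have "\<dots> = poly (map_poly of_int (wheel_poly n)) s"
      unfolding poly_altdef
      using order_trans[OF map_poly_degree_leq degree_wheel_poly]
      by (intro sum.mono_neutral_right) (auto simp: coeff_eq_0)
    also have "\<dots> = wheel_form s (s * (s - 1 + inverse s)) n"
      unfolding poly_wheel_poly using s0 by (simp add: algebra_simps power2_eq_square)
    also have "\<dots> = s ^ (n - 1) * wheel_form 1 (s - 1 + inverse s) n"
      unfolding m wheel_form_homogeneous by simp
    also have "s - 1 + inverse s = - (1 + sqrt_t ^ 2 + inverse (sqrt_t ^ 2))"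
      by (simp add: s_def)
    finally show ?thesis
      unfolding alexander_weaving_braid by (simp add: c_def)
  qed
  ultimately show ?thesis unfolding is_alexander_in_s_def s_def by blast
qed

subsection \<open>Trapezoidality\<close>

text \<open>\<open>gap_fps\<close> and \<open>root_fps\<close> are the series \<open>g\<close> and \<open>v = z + g\<close>.\<close>

fun gap_seq :: "nat \<Rightarrow> nat" where
  "gap_seq 0 = 0"
| "gap_seq (Suc n) = (if n = 1 then 1 else 0) + gap_seq n + (if n = 0 then 0 else gap_seq (n - 1)) +
     (\<Sum>i\<le>n. gap_seq i * gap_seq (n - i))"

definition gap_fps :: "real fps" where
  "gap_fps = Abs_fps (\<lambda>n. real (gap_seq n))"

definition root_fps :: "real fps" where
  "root_fps = fps_X + gap_fps"

lemma gap_fps_eq: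
  "gap_fps = fps_X ^ 2 + fps_X * gap_fps + fps_X ^ 2 * gap_fps + fps_X * gap_fps ^ 2"
proof (rule fps_ext)
  fix n
  show "fps_nth gap_fps n = fps_nth (fps_X ^ 2 + fps_X * gap_fps + fps_X ^ 2 * gap_fps + fps_X * gap_fps ^ 2) n"
  proof (cases n)
    case 0
    then show ?thesis by (simp add: gap_fps_def)
  next
    case (Suc m)
    have "fps_nth (gap_fps ^ 2) m = real (\<Sum>i\<le>m. gap_seq i * gap_seq (m - i))"
      by (simp add: power2_eq_square fps_mult_nth gap_fps_def atLeast0AtMost)
    then show ?thesis
      by (simp add: Suc gap_fps_def fps_X_power_mult_nth fps_X_power_nth)
  qed
qed

lemma root_fps_fixpoint: "root_fps * (1 - fps_X - fps_X * gap_fps) = fps_X"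
  using gap_fps_eq unfolding root_fps_def by algebra

text \<open>Equivalently v/(1 + v) = z/(1 - z g), which trades 1 + v for a denominator with
  nonnegative expansion.\<close>

lemma root_fps_conjugate: "root_fps * (1 - fps_X * gap_fps) = fps_X * (1 + root_fps)"
  using root_fps_fixpoint by (simp add: algebra_simps)

lemma root_fps_quadratic: "fps_X * (1 + root_fps ^ 2) = root_fps * (1 - fps_X + fps_X ^ 2)"
proof -
  have "root_fps * (1 - fps_X + fps_X ^ 2) =
      root_fps * (1 - fps_X - fps_X * gap_fps) + fps_X * root_fps * root_fps"
    by (simp add: root_fps_def algebra_simps power2_eq_square)
  then show ?thesis
    unfolding root_fps_fixpoint by (simp add: algebra_simps power2_eq_square)
qed

section \<open>Power series with nonnegative coefficients\<close>

definition fps_nonneg :: "real fps \<Rightarrow> bool" where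
  "fps_nonneg f \<longleftrightarrow> (\<forall>n. 0 \<le> fps_nth f n)"

lemma fps_nonnegD: "fps_nonneg f \<Longrightarrow> 0 \<le> fps_nth f n"
  by (simp add: fps_nonneg_def)

lemma fps_nonneg_mult: "fps_nonneg f \<Longrightarrow> fps_nonneg g \<Longrightarrow> fps_nonneg (f * g)"
  by (auto simp: fps_nonneg_def fps_mult_nth intro!: sum_nonneg)

lemma fps_nonneg_power: "fps_nonneg f \<Longrightarrow> fps_nonneg (f ^ k)"
  by (induction k) (simp add: fps_nonneg_def, simp add: fps_nonneg_mult)

lemma fps_mult_nth_ge:
  assumes "fps_nonneg f" "fps_nonneg g"
  shows "fps_nth f i * fps_nth g j \<le> fps_nth (f * g) (i + j)"
proof -
  have "(\<Sum>k\<in>{i}. fps_nth f k * fps_nth g (i + j - k)) \<le> fps_nth (f * g) (i + j)"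
    unfolding fps_mult_nth using assms by (intro sum_mono2) (auto simp: fps_nonneg_def)
  then show ?thesis by simp
qed

text \<open>The inverse G satisfies G = 1 + f G, and f has no constant term, so each coefficient of
  G depends nonnegatively on earlier ones.\<close>

lemma fps_nonneg_geometric:
  assumes "fps_nonneg f" "fps_nth f 0 = 0"
  shows "fps_nonneg (inverse (1 - f))"
proof -
  let ?g = "inverse (1 - f)"
  have "(1 - f) * ?g = 1"
    using assms by (intro inverse_mult_eq_1') simp
  then have g: "?g = 1 + f * ?g"
    by (simp add: algebra_simps)
  have "0 \<le> fps_nth ?g n" for n
  proof (induction n rule: less_induct)
    case (less n)
    have "fps_nth ?g n = fps_nth 1 n + fps_nth (f * ?g) n"
      by (subst g) simp
    moreover have "0 \<le> fps_nth (f * ?g) n"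
      unfolding fps_mult_nth
    proof (intro sum_nonneg)
      fix i assume "i \<in> {0..n}"
      then show "0 \<le> fps_nth f i * fps_nth ?g (n - i)"
        using assms less by (cases "i = 0") (auto simp: fps_nonneg_def)
    qed
    ultimately show ?case by (simp add: fps_one_nth)
  qed
  then show ?thesis by (simp add: fps_nonneg_def)
qed

lemma gap_seq_pos: "n \<ge> 2 \<Longrightarrow> gap_seq n \<ge> 1"
proof (induction n rule: dec_induct)
  case base
  show ?case by (simp add: numeral_2_eq_2)
qed (simp add: numeral_2_eq_2)

lemma root_fps_nth_0 [simp]: "fps_nth root_fps 0 = 0"
  by (simp add: root_fps_def gap_fps_def)

lemma root_fps_nth_ge_1:
  assumes "n \<ge> 1"
  shows "1 \<le> fps_nth root_fps n"
proof (cases "n = 1")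
  case False
  then show ?thesis
    using assms gap_seq_pos[of n] by (simp add: root_fps_def gap_fps_def fps_X_nth)
qed (simp add: root_fps_def gap_fps_def)

lemma fps_nonneg_root: "fps_nonneg root_fps"
  by (simp add: fps_nonneg_def root_fps_def gap_fps_def fps_X_nth)

lemma root_fps_power_nth_ge_1: "m \<le> n \<Longrightarrow> m \<ge> 1 \<Longrightarrow> 1 \<le> fps_nth (root_fps ^ m) n"
proof (induction m arbitrary: n)
  case (Suc m)
  show ?case
  proof (cases "m = 0")
    case True
    then show ?thesis using Suc.prems root_fps_nth_ge_1[of n] by simp
  next
    case False
    have "1 \<le> fps_nth root_fps 1" "1 \<le> fps_nth (root_fps ^ m) (n - 1)"
      using Suc False root_fps_nth_ge_1[of 1] by auto
    then have "1 \<le> fps_nth root_fps 1 * fps_nth (root_fps ^ m) (n - 1)"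
      by (metis mult_ge1_I)
    also have "\<dots> \<le> fps_nth (root_fps * root_fps ^ m) (1 + (n - 1))"
      by (intro fps_mult_nth_ge fps_nonneg_root fps_nonneg_power)
    finally show ?thesis using Suc.prems by simp
  qed
qed simp

definition center_fps :: "real fps" where
  "center_fps = (1 + fps_X) * inverse (1 - fps_X) * inverse (1 - fps_X * gap_fps)"

text \<open>The recurrence gives \<Sum> P_n z^n = z (1 + z) / ((1 - z)(1 - \<tau> z + z^2)). Its
  coefficient at s^0 is (1 + z)/(1 - z) times v/(1 - v^2), rewritten here by
  \<open>root_fps_conjugate\<close>.\<close>

definition central_fps :: "real fps" where
  "central_fps = fps_X * center_fps * inverse (1 - root_fps)"

text \<open>The coefficient of \<open>s\<^sup>j\<close> in \<open>P\<^sub>n\<close>; in \<open>wheel_poly n\<close> it sits at index \<open>j + n - 1\<close>.\<close>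

definition centered_coeff :: "nat \<Rightarrow> int \<Rightarrow> real" where
  "centered_coeff n j = fps_nth (central_fps * root_fps ^ nat \<bar>j\<bar>) n"

lemma geometric_inverse:
  assumes "fps_nth f 0 = (0 :: real)"
  shows "(1 - f) * inverse (1 - f) = 1"
  using assms by (intro inverse_mult_eq_1') simp

lemma fps_nonneg_center: "fps_nonneg center_fps"
  unfolding center_fps_def
proof (intro fps_nonneg_mult fps_nonneg_geometric)
  show "fps_nonneg (1 + fps_X)" "fps_nonneg fps_X" "fps_nonneg gap_fps"
    "fps_nonneg fps_X"
    by (simp_all add: fps_nonneg_def gap_fps_def)
qed simp_all

lemma center_fps_nth_0: "fps_nth center_fps 0 = 1"
  by (simp add: center_fps_def)

lemma center_fps_nth_ge_1: "1 \<le> fps_nth center_fps n"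
proof -
  let ?Y = "inverse (1 - fps_X * gap_fps)"
  have Y: "fps_nonneg ?Y"
    by (intro fps_nonneg_geometric fps_nonneg_mult)
      (simp_all add: fps_nonneg_def fps_X_nth gap_fps_def)
  note X = fps_inverse_one_minus_fps_X[where 'a = real]
  \<comment> \<open>The series is 1 + 2z + 2z^2 + ...\<close>
  have 1: "fps_nth ((1 + fps_X) * inverse (1 - fps_X :: real fps)) n \<ge> 1" for n
    by (cases n) (simp_all add: X distrib_right)
  have "1 * fps_nth ?Y 0 \<le> fps_nth ((1 + fps_X) * inverse (1 - fps_X)) n * fps_nth ?Y 0"
    using 1[of n] by simp
  also have "\<dots> \<le> fps_nth center_fps (n + 0)"
    unfolding center_fps_def
    by (intro fps_mult_nth_ge Y) (use 1 in \<open>auto simp: fps_nonneg_def intro: order_trans[OF zero_le_one]\<close>)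
  finally show ?thesis by simp
qed

text \<open>The factor 1 - v of v^m - v^(m+1) cancels the denominator 1 - v of
  \<open>central_fps\<close>.\<close>

lemma centered_coeff_diff:
  "centered_coeff n (int m) - centered_coeff n (int m + 1) = fps_nth (fps_X * (center_fps * root_fps ^ m)) n"
proof -
  have "central_fps * root_fps ^ m - central_fps * root_fps ^ Suc m =
      fps_X * (center_fps * root_fps ^ m) * ((1 - root_fps) * inverse (1 - root_fps))"
    unfolding central_fps_def by (simp add: algebra_simps)
  then have "central_fps * root_fps ^ m - central_fps * root_fps ^ Suc m =
      fps_X * (center_fps * root_fps ^ m)"
    by (simp add: geometric_inverse)
  from this[THEN arg_cong[where f = "\<lambda>f. fps_nth f n"]] show ?thesis
    by (simp add: centered_coeff_def nat_add_distrib)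
qed

lemma centered_coeff_decreasing:
  assumes "m < n"
  shows "centered_coeff n (int m + 1) < centered_coeff n (int m)"
proof -
  obtain k where n: "n = Suc k" using assms by (cases n) auto
  have "1 \<le> fps_nth (center_fps * root_fps ^ m) k"
  \<comment> \<open>For \<open>m = 0\<close> the power of v is 1, so the bound must come from
    \<open>center_fps\<close>; otherwise v^m supplies it, as k >= m.\<close>
  proof (cases "m = 0")
    case True
    then show ?thesis by (simp add: center_fps_nth_ge_1)
  next
    case False
    have "1 * 1 \<le> fps_nth center_fps 0 * fps_nth (root_fps ^ m) k"
      using root_fps_power_nth_ge_1[of m k] False assms n by (simp add: center_fps_nth_0)
    also have "\<dots> \<le> fps_nth (center_fps * root_fps ^ m) (0 + k)"
      by (intro fps_mult_nth_ge fps_nonneg_center fps_nonneg_power fps_nonneg_root)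
    finally show ?thesis by simp
  qed
  then show ?thesis
    using centered_coeff_diff[of n m] n by simp
qed

lemma centered_coeff_nonneg: "0 \<le> centered_coeff n j"
  unfolding centered_coeff_def central_fps_def
  by (intro fps_nonnegD fps_nonneg_mult fps_nonneg_geometric fps_nonneg_center
      fps_nonneg_power fps_nonneg_root root_fps_nth_0) (simp add: fps_nonneg_def fps_X_nth)

lemma centered_coeff_minus [simp]: "centered_coeff n (- j) = centered_coeff n j"
  by (simp add: centered_coeff_def)

text \<open>Since z divides v, the series is divisible by z^(|j|+1).\<close>

lemma centered_coeff_eq_0:
  assumes "int n \<le> \<bar>j\<bar>"
  shows "centered_coeff n j = 0"
proof -
  define g where "g = inverse (1 - fps_X - fps_X * gap_fps)"
  have "(1 - fps_X - fps_X * gap_fps) * g = 1"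
    unfolding g_def by (intro inverse_mult_eq_1') simp
  then have g: "root_fps = fps_X * g"
    using root_fps_fixpoint by (metis mult.assoc mult.right_neutral)
  have "central_fps * root_fps ^ nat \<bar>j\<bar> =
      fps_X ^ Suc (nat \<bar>j\<bar>) * (center_fps * inverse (1 - root_fps) * g ^ nat \<bar>j\<bar>)"
    unfolding central_fps_def using g by (metis (no_types, lifting) mult.assoc mult.commute power_Suc power_mult_distrib)
  then show ?thesis using assms by (simp add: centered_coeff_def fps_X_power_mult_nth del: power_Suc)
qed

section \<open>Recurrence for the centred coefficients and comparison with
  \<open>wheel_poly\<close>\<close>

lemma central_fps_rec:
  "central_fps * (1 + fps_X ^ 2) =
    fps_X * (central_fps + 2 * (central_fps * root_fps)) + fps_X * ((1 + fps_X) * inverse (1 - fps_X))"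
proof -
  define D :: "real fps" where "D = (1 + fps_X) * inverse (1 - fps_X)"
  define Y where "Y = inverse (1 - fps_X * gap_fps)"
  define W where "W = inverse (1 - root_fps)"
  have Y: "(1 - fps_X * gap_fps) * Y = 1"
    unfolding Y_def by (rule geometric_inverse) simp
  have W: "(1 - root_fps) * W = 1"
    unfolding W_def by (rule geometric_inverse) simp
  have A: "central_fps = fps_X * D * Y * W"
    by (simp add: central_fps_def center_fps_def D_def Y_def W_def mult_ac)
  have v: "root_fps = fps_X * (1 + root_fps) * Y"
    using Y root_fps_conjugate by algebra
  \<comment> \<open>Multiplying by v makes \<open>root_fps_quadratic\<close> applicable; v is
    cancelled afterwards. The doubled term stands for the equal coefficients at s and 1/s.\<close>
  have "root_fps * (central_fps * (1 + fps_X ^ 2)) =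
     root_fps * (fps_X * (central_fps + 2 * (central_fps * root_fps)) + fps_X * D)"
    using v W A root_fps_quadratic by algebra
  moreover have "root_fps \<noteq> 0"
    using root_fps_nth_ge_1[of 1] by auto
  ultimately show ?thesis unfolding D_def by simp
qed

lemma centered_coeff_rec_nonneg:
  assumes "j \<ge> 0"
  shows "centered_coeff (n + 2) j = centered_coeff (n + 1) (j - 1) + centered_coeff (n + 1) j +
    centered_coeff (n + 1) (j + 1) - centered_coeff n j + (if j = 0 then 2 else 0)"
proof (cases "j = 0")
  case True
  note X = fps_inverse_one_minus_fps_X[where 'a = real]
  have "fps_nth (fps_X * ((1 + fps_X) * inverse (1 - fps_X :: real fps))) (n + 2) = 2"
    by (simp add: X distrib_right numeral_2_eq_2)
  moreover have "fps_nth (central_fps * (1 + fps_X ^ 2)) (n + 2) = centered_coeff (n + 2) 0 + centered_coeff n 0"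
    unfolding distrib_left fps_add_nth fps_X_power_mult_right_nth by (simp add: centered_coeff_def)
  moreover have "fps_nth (fps_X * (central_fps + 2 * (central_fps * root_fps))) (n + 2) =
      centered_coeff (n + 1) 0 + 2 * centered_coeff (n + 1) 1"
    unfolding mult_2 by (simp add: centered_coeff_def)
  ultimately show ?thesis
    using arg_cong[OF central_fps_rec, of "\<lambda>f. fps_nth f (n + 2)"] True
      centered_coeff_minus[of "n + 1" 1]
    unfolding fps_add_nth by simp
next
  case False
  then obtain k where k: "j = int (Suc k)" using assms by (metis not0_implies_Suc nonneg_int_cases of_nat_0)
  have "central_fps * root_fps ^ Suc k * (1 + fps_X ^ 2) =
      fps_X * (central_fps * root_fps ^ k + central_fps * root_fps ^ Suc k + central_fps * root_fps ^ Suc (Suc k))"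
  proof -
    define u where "u = root_fps ^ k"
    show ?thesis
      unfolding power_Suc u_def[symmetric] using root_fps_quadratic by algebra
  qed
  from arg_cong[OF this, of "\<lambda>f. fps_nth f (n + 2)"]
  have "fps_nth (central_fps * root_fps ^ Suc k) (n + 2) + fps_nth (central_fps * root_fps ^ Suc k) n =
      fps_nth (central_fps * root_fps ^ k) (n + 1) + fps_nth (central_fps * root_fps ^ Suc k) (n + 1) +
      fps_nth (central_fps * root_fps ^ Suc (Suc k)) (n + 1)"
    unfolding distrib_left[of _ 1] fps_add_nth fps_X_power_mult_right_nth by (simp del: power_Suc)
  then show ?thesis
    by (simp add: k centered_coeff_def nat_add_distrib del: power_Suc)
qed

lemma centered_coeff_rec:
  "centered_coeff (n + 2) j = centered_coeff (n + 1) (j - 1) + centered_coeff (n + 1) j +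
    centered_coeff (n + 1) (j + 1) - centered_coeff n j + (if j = 0 then 2 else 0)"
proof (cases "j \<ge> 0")
  case False
  have "- j - 1 = - (j + 1)" "- j + 1 = - (j - 1)" by simp_all
  then show ?thesis
    using centered_coeff_rec_nonneg[of "- j" n] False by (simp only: centered_coeff_minus) simp
qed (rule centered_coeff_rec_nonneg)

lemma centered_coeff_0 [simp]: "centered_coeff 0 j = 0"
  by (simp add: centered_coeff_eq_0)

lemma centered_coeff_1: "centered_coeff (Suc 0) j = (if j = 0 then 1 else 0)"
proof (cases "j = 0")
  case True
  have "fps_nth (center_fps * inverse (1 - root_fps)) 0 = 1"
    by (simp add: center_fps_nth_0)
  then show ?thesis using True by (simp add: centered_coeff_def central_fps_def mult.assoc)
next
  case False
  then show ?thesis by (simp add: centered_coeff_eq_0)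
qed

lemma wheel_poly_rec:
  "wheel_poly (n + 2) = [:1, 1, 1:] * wheel_poly (n + 1) - monom 1 2 * wheel_poly n + monom 2 (n + 1)"
proof -
  have "[:1, - 1, 1:] + 2 * [:0, 1 :: int:] = [:1, 1, 1:]"
    by (simp add: numeral_poly)
  moreover have "2 * [:0, 1 :: int:] ^ (n + 1) = monom 2 (n + 1)"
    by (simp add: monom_altdef numeral_poly)
  ultimately show ?thesis
    unfolding wheel_poly_def wheel_form_rec by (simp only: monom_altdef) simp
qed

lemma coeff_wheel_poly: "real_of_int (coeff (wheel_poly n) k) = centered_coeff n (int k - int n + 1)"
proof (induction n arbitrary: k rule: less_induct)
  case (less n)
  consider "n = 0" | "n = 1" | m where "n = m + 2"
    by (metis One_nat_def add_2_eq_Suc' not0_implies_Suc)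
  then show ?case
  proof cases
    case 1
    then show ?thesis by (simp add: wheel_poly_def)
  next
    case 2
    then show ?thesis by (simp add: wheel_poly_def centered_coeff_1 coeff_1)
  next
    case 3
    \<comment> \<open>Extension by zero to negative indices avoids cases at k < 2;
      \<open>centered_coeff\<close> vanishes there as well.\<close>
    define c where "c i = (if i < 0 then 0 else coeff (wheel_poly (m + 1)) (nat i))" for i :: int
    have c: "real_of_int (c i) = centered_coeff (m + 1) (i - int m)" for i
      using less[of "m + 1" "nat i"] by (auto simp: c_def 3 centered_coeff_eq_0)
    have 1: "real_of_int (coeff (monom 1 2 * wheel_poly m) k) = centered_coeff m (int k - int m - 1)"
      using less[of m "k - 2"] by (auto simp: coeff_monom_mult 3 centered_coeff_eq_0 of_nat_diff)
    have 2: "coeff ([:1, 1, 1:] * wheel_poly (m + 1)) k = c (int k) + c (int k - 1) + c (int k - 2)"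
      by (auto simp: c_def coeff_pCons nat_diff_distrib split: nat.split)
    have "real_of_int (coeff (wheel_poly n) k) =
        centered_coeff (m + 1) (int k - int m) + centered_coeff (m + 1) (int k - 1 - int m) +
        centered_coeff (m + 1) (int k - 2 - int m) - centered_coeff m (int k - int m - 1) +
        (if k = m + 1 then 2 else 0)"
      unfolding 3 wheel_poly_rec coeff_add coeff_diff 2 of_int_add of_int_diff 1 c by simp
    moreover have "int k - int n + 1 = int k - int m - 1"
      by (simp add: 3)
    moreover have "int k - int m - 1 = 0 \<longleftrightarrow> k = m + 1"
      by linarith
    ultimately show ?thesis
      using centered_coeff_rec[of m "int k - int m - 1"] by (simp add: 3 algebra_simps)
  qed
qed

lemma trapezoidal_wheel_poly:
  assumes "n \<ge> 1"
  shows "trapezoidal (n - 1) (\<lambda>k. real_of_int (coeff (wheel_poly n) k))"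
  unfolding trapezoidal_def
\<comment> \<open>Here r = 0: the maximum is attained only at the middle index n - 1.\<close>
proof (intro conjI exI[of _ 0] allI impI ballI)
  fix k assume "k \<le> 2 * (n - 1)"
  define m where "m = nat \<bar>int k - int n + 1\<bar>"
  have "m < n" using \<open>k \<le> 2 * (n - 1)\<close> assms by (auto simp: m_def)
  then have "0 < centered_coeff n (int m)"
    using centered_coeff_decreasing[of m n] centered_coeff_nonneg[of n "int m + 1"] by linarith
  then show "0 < real_of_int (coeff (wheel_poly n) k)"
    by (simp add: coeff_wheel_poly m_def centered_coeff_def)
next
  fix k assume "k < n - 1 - 0"
  then have "int k - int n + 1 = - (int (n - 2 - k) + 1)" "int (Suc k) - int n + 1 = - int (n - 2 - k)"
    by linarith+
  then show "real_of_int (coeff (wheel_poly n) k) < real_of_int (coeff (wheel_poly n) (Suc k))"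
    using centered_coeff_decreasing[of "n - 2 - k" n] assms
    unfolding coeff_wheel_poly by (simp only: centered_coeff_minus)
next
  fix k assume k: "k \<in> {n - 1 + 0..<2 * (n - 1)}"
  then have "int k - int n + 1 = int (k - (n - 1))" "int (Suc k) - int n + 1 = int (k - (n - 1)) + 1"
    using assms by auto
  moreover have "k - (n - 1) < n" using assms k by auto
  ultimately show "real_of_int (coeff (wheel_poly n) k) > real_of_int (coeff (wheel_poly n) (Suc k))"
    unfolding coeff_wheel_poly by (simp only: centered_coeff_decreasing)
qed auto

theorem theorem1p2:
  fixes n :: nat
  assumes "n \<ge> 1"
  shows "\<exists>a :: nat \<Rightarrow> int.
    (\<forall>k\<le>2 * n - 2. real_of_int (a k) = alpha n k) \<and>
    is_alexander_in_s (weaving_braid n)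
      (\<Sum>k\<le>2 * n - 2. Poly_Mapping.single (int k) (a k)) \<and>
    trapezoidal (n - 1) (\<lambda>k. real_of_int (a k))"
  using alpha_eq_coeff[of n] is_alexander_weaving_braid[OF assms] trapezoidal_wheel_poly[OF assms]
  by (intro exI[of _ "coeff (wheel_poly n)"]) simp

end
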